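(* Let $n$ be a positive integer and let $X_1,\ldots,X_n$ be independent random variables such that $0\le X_i\le 1$ for each $i=1,\ldots,n$. Set $p=\frac1n\sum_{i=1}^n \mathbb{E}[X_i]$. Then, for any positive real $t$ such that $np<t<n$, we have $$\mathbb{P}\left[\sum_{i=1}^n X_i\ge t\right]\le \inf_{f\in\mathcal{F}_{sic}}\left\{\frac{1}{f(t)}\left\{(1-p)f(0)+pf(1)\right\}^n\right\}.$$
   Context: A function $f:[0,+\infty)\to[0,+\infty)$ is called sub-multiplicative if $f(x+y)\le f(x)f(y)$ for all $x,y\in[0,+\infty)$. $\mathcal{F}_{sic}$ denotes the set of all functions $f:[0,+\infty)\to[0,+\infty)$ that are sub-multiplicative, increasing (in the sense of nondecreasing) and convex. The infimum is over those $f\in\mathcal{F}_{sic}$ with $f(t)>0$. *)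

theory Defs
  imports "HOL-Probability.Probability"
begin

text \<open>Functions from \<open>[0,\<infinity>)\<close> to \<open>[0,\<infinity>)\<close> are represented by total functions
  \<open>real \<Rightarrow> real\<close>; values at negative arguments are unconstrained and irrelevant.\<close>

definition submultiplicative :: "(real \<Rightarrow> real) \<Rightarrow> bool" where
  "submultiplicative f \<longleftrightarrow> (\<forall>x\<in>{0..}. \<forall>y\<in>{0..}. f (x + y) \<le> f x * f y)"

definition F_sic :: "(real \<Rightarrow> real) set" where
  "F_sic = {f. f \<in> {0..} \<rightarrow> {0..} \<and> submultiplicative f \<and> mono_on {0..} f \<and> convex_on {0..} f}"

end

theory Submission
  imports Defs
begin

text \<open>
  The bound is the Chernoff--Hoeffding argument with \<open>exp\<close> replaced by any
  \<open>f \<in> F_sic\<close>, since each of the three defining properties takes over the role of one feature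
  of the exponential. Let \<open>S\<close> be the sum of the \<open>X i\<close>.
  Monotonicity gives Markov's inequality \<open>f t * P (S \<ge> t) \<le> E (f S)\<close>; sub-multiplicativity and
  independence give \<open>E (f S) \<le> (\<Prod>i. E (f (X i)))\<close>
  (\<open>submultiplicative_sum_le_prod\<close>); convexity puts \<open>f\<close> below its chord on \<open>[0, 1]\<close>, so that
  \<open>E (f (X i)) \<le> (1 - p\<^sub>i) * f 0 + p\<^sub>i * f 1\<close> with \<open>p\<^sub>i = E (X i)\<close>
  (\<open>expectation_unit_clamp_le_chord\<close>). The chord is affine in \<open>p\<^sub>i\<close>, so the inequality of
  arithmetic and geometric means (\<open>prod_le_mean_power\<close>) replaces the product by the \<open>n\<close>-th power
  of the chord at the average \<open>p\<close>. As the real infimum of the empty set is unspecified, one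
  also has to exhibit a member of \<open>F_sic\<close> that is positive at \<open>t\<close>; \<open>exp\<close> serves.

  A technical point is that \<open>f\<close> is arbitrary on negative arguments, and the \<open>X i\<close> lie in
  \<open>[0, 1]\<close> only almost surely. Composing \<open>f\<close> with the truncation to \<open>[0, 1]\<close> yields a bounded
  monotone, hence Borel, function on the whole line; independence passes to the variables
  \<open>f (unit_clamp (X i))\<close>, and the truncation changes nothing outside a null set.
\<close>

lemma submultiplicative_sum_le_prod:
  fixes y :: "'i \<Rightarrow> real"
  assumes "finite I" "I \<noteq> {}" "submultiplicative f"
    and "\<And>x. x \<ge> 0 \<Longrightarrow> f x \<ge> 0" "\<And>i. i \<in> I \<Longrightarrow> y i \<ge> 0"
  shows "f (\<Sum>i\<in>I. y i) \<le> (\<Prod>i\<in>I. f (y i))"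
  using assms(1,2,5)
proof (induction I rule: finite_ne_induct)
  case (singleton i)
  then show ?case by simp
next
  case (insert i I)
  have "f (y i + (\<Sum>j\<in>I. y j)) \<le> f (y i) * f (\<Sum>j\<in>I. y j)"
    using assms(3) insert.prems by (auto simp: submultiplicative_def sum_nonneg)
  also have "\<dots> \<le> f (y i) * (\<Prod>j\<in>I. f (y j))"
    using insert assms(4) by (intro mult_left_mono) auto
  finally show ?case using insert.hyps by simp
qed

lemma exp_in_F_sic: "exp \<in> F_sic"
  using convex_on_subset[OF exp_convex]
  by (auto simp: F_sic_def submultiplicative_def exp_add mono_on_def)

lemma prod_le_mean_power:
  fixes x :: "'i \<Rightarrow> real"
  assumes "finite I" "I \<noteq> {}" "\<And>i. i \<in> I \<Longrightarrow> x i \<ge> 0"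
  shows "(\<Prod>i\<in>I. x i) \<le> ((\<Sum>i\<in>I. x i) / card I) ^ card I"
proof -
  have c: "card I > 0" using assms by (simp add: card_gt_0_iff)
  have nonneg: "(\<Prod>i\<in>I. x i) \<ge> 0" using assms by (intro prod_nonneg) auto
  have "(\<Prod>i\<in>I. x i) = ((\<Prod>i\<in>I. x i) powr (1 / card I)) ^ card I"
    using c nonneg by (simp add: real_root_pow_pos2 flip: root_powr_inverse)
  also have "\<dots> \<le> ((\<Sum>i\<in>I. x i) / card I) ^ card I"
    using arith_geom_mean[of I x] assms by (intro power_mono) (auto simp: sum_divide_distrib)
  finally show ?thesis .
qed

definition unit_clamp :: "real \<Rightarrow> real" where
  "unit_clamp x = max 0 (min 1 x)"

lemma unit_clamp_bounds: "0 \<le> unit_clamp x" "unit_clamp x \<le> 1"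
  by (auto simp: unit_clamp_def)

lemma unit_clamp_eq: "0 \<le> x \<Longrightarrow> x \<le> 1 \<Longrightarrow> unit_clamp x = x"
  by (auto simp: unit_clamp_def)

lemma borel_measurable_mono_on_unit_clamp:
  fixes f :: "real \<Rightarrow> real"
  assumes "mono_on {0..} f"
  shows "(\<lambda>x. f (unit_clamp x)) \<in> borel_measurable borel"
  by (rule borel_measurable_mono)
    (auto intro!: monoI mono_onD[OF assms] simp: unit_clamp_def)

lemma unit_clamp_value_bounds:
  assumes "f \<in> F_sic"
  shows "0 \<le> f (unit_clamp x)" "f (unit_clamp x) \<le> f 1"
  using assms mono_onD[of "{0..}" f "unit_clamp x" 1] unit_clamp_bounds[of x]
  by (auto simp: F_sic_def)

context prob_space
begin

lemma integrable_unit_interval: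
  assumes "random_variable borel X" "AE \<omega> in M. 0 \<le> X \<omega> \<and> X \<omega> \<le> (1::real)"
  shows "integrable M X"
  using assms by (intro integrable_const_bound[where B=1]) auto

lemma integrable_unit_clamp:
  assumes "f \<in> F_sic" "random_variable borel X"
  shows "integrable M (\<lambda>\<omega>. f (unit_clamp (X \<omega>)))"
proof (rule integrable_const_bound[where B="f 1"])
  show "AE \<omega> in M. norm (f (unit_clamp (X \<omega>))) \<le> f 1"
    using unit_clamp_value_bounds[OF assms(1)] by auto
  show "(\<lambda>\<omega>. f (unit_clamp (X \<omega>))) \<in> borel_measurable M"
    using assms by (intro measurable_compose[OF assms(2) borel_measurable_mono_on_unit_clamp])
      (auto simp: F_sic_def)
qed

text \<open>On \<open>[0, 1]\<close> the graph of a convex function lies below its chord; taking expectations of the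
  chord, which is affine, only involves the mean of \<open>X\<close>.\<close>

lemma expectation_unit_clamp_le_chord:
  assumes f: "f \<in> F_sic" and X: "random_variable borel X"
    and ae: "AE \<omega> in M. 0 \<le> X \<omega> \<and> X \<omega> \<le> 1"
  shows "expectation (\<lambda>\<omega>. f (unit_clamp (X \<omega>)))
    \<le> (1 - expectation X) * f 0 + expectation X * f 1"
proof -
  have int: "integrable M X" by (rule integrable_unit_interval[OF X ae])
  have conv: "convex_on {0..} f" using f by (simp add: F_sic_def)
  have "expectation (\<lambda>\<omega>. f (unit_clamp (X \<omega>))) \<le> expectation (\<lambda>\<omega>. f 0 + (f 1 - f 0) * X \<omega>)"
  proof (rule integral_mono_AE)
    show "integrable M (\<lambda>\<omega>. f (unit_clamp (X \<omega>)))" by (rule integrable_unit_clamp[OF f X])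
    show "integrable M (\<lambda>\<omega>. f 0 + (f 1 - f 0) * X \<omega>)" using int by simp
    show "AE \<omega> in M. f (unit_clamp (X \<omega>)) \<le> f 0 + (f 1 - f 0) * X \<omega>"
      using ae
    proof eventually_elim
      case (elim \<omega>)
      have "f (X \<omega>) \<le> (1 - X \<omega>) * f 0 + X \<omega> * f 1"
        using convex_onD[OF conv, of "X \<omega>" 0 1] elim by simp
      then show ?case using elim by (simp add: unit_clamp_eq algebra_simps)
    qed
  qed
  also have "\<dots> = (1 - expectation X) * f 0 + expectation X * f 1"
    using int by (simp add: prob_space algebra_simps)
  finally show ?thesis .
qed

text \<open>Markov's inequality combined with sub-multiplicativity: on \<open>{\<Sum> X i \<ge> t}\<close> the constant
  \<open>f t\<close> is almost surely at most \<open>\<Prod> f (X i)\<close>, whose expectation factorises.\<close>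

lemma markov_submultiplicative:
  assumes I: "finite I" "I \<noteq> {}" and ind: "indep_vars (\<lambda>_. borel) X I"
    and ae: "\<And>i. i \<in> I \<Longrightarrow> AE \<omega> in M. 0 \<le> X i \<omega> \<and> X i \<omega> \<le> 1"
    and f: "f \<in> F_sic" and t: "t \<ge> 0"
  shows "f t * prob {\<omega> \<in> space M. (\<Sum>i\<in>I. X i \<omega>) \<ge> t}
    \<le> (\<Prod>i\<in>I. expectation (\<lambda>\<omega>. f (unit_clamp (X i \<omega>))))"
proof -
  define A where "A = {\<omega> \<in> space M. (\<Sum>i\<in>I. X i \<omega>) \<ge> t}"
  have rv: "random_variable borel (X i)" if "i \<in> I" for i
    using ind that by (auto simp: indep_vars_def)
  have sumX: "random_variable borel (\<lambda>\<omega>. \<Sum>i\<in>I. X i \<omega>)"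
    using rv by (intro borel_measurable_sum) auto
  have A: "A \<in> events" unfolding A_def using sumX by measurable
  have mono: "mono_on {0..} f" and sub: "submultiplicative f"
    and nonneg: "\<And>x. x \<ge> 0 \<Longrightarrow> f x \<ge> 0"
    using f by (auto simp: F_sic_def)
  have ind': "indep_vars (\<lambda>_. borel) (\<lambda>i \<omega>. f (unit_clamp (X i \<omega>))) I"
    by (rule indep_vars_compose2[OF ind borel_measurable_mono_on_unit_clamp[OF mono]])
  have int: "integrable M (\<lambda>\<omega>. f (unit_clamp (X i \<omega>)))" if "i \<in> I" for i
    by (rule integrable_unit_clamp[OF f rv[OF that]])
  have all: "AE \<omega> in M. \<forall>i\<in>I. 0 \<le> X i \<omega> \<and> X i \<omega> \<le> 1"
    using ae I(1) by (intro AE_finite_allI) auto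
  have "f t * prob A = expectation (\<lambda>\<omega>. f t * indicator A \<omega>)"
    using A by simp
  also have "\<dots> \<le> expectation (\<lambda>\<omega>. \<Prod>i\<in>I. f (unit_clamp (X i \<omega>)))"
  proof (rule integral_mono_AE)
    show "integrable M (\<lambda>\<omega>. f t * indicator A \<omega>)"
      using A by (intro integrable_mult_right) (simp add: emeasure_eq_measure)
    show "integrable M (\<lambda>\<omega>. \<Prod>i\<in>I. f (unit_clamp (X i \<omega>)))"
      by (rule indep_vars_integrable[OF I(1) ind' int])
    show "AE \<omega> in M. f t * indicator A \<omega> \<le> (\<Prod>i\<in>I. f (unit_clamp (X i \<omega>)))"
      using all
    proof eventually_elim
      case (elim \<omega>)
      show ?case
      proof (cases "\<omega> \<in> A")
        case True
        have "f t \<le> f (\<Sum>i\<in>I. X i \<omega>)"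
          using True t by (intro mono_onD[OF mono]) (auto simp: A_def)
        also have "\<dots> \<le> (\<Prod>i\<in>I. f (X i \<omega>))"
          using elim by (intro submultiplicative_sum_le_prod I sub nonneg) auto
        also have "\<dots> = (\<Prod>i\<in>I. f (unit_clamp (X i \<omega>)))"
          using elim by (intro prod.cong) (auto simp: unit_clamp_eq)
        finally show ?thesis using True by simp
      next
        case False
        then show ?thesis
          using unit_clamp_value_bounds(1)[OF f] by (auto intro: prod_nonneg)
      qed
    qed
  qed
  also have "\<dots> = (\<Prod>i\<in>I. expectation (\<lambda>\<omega>. f (unit_clamp (X i \<omega>))))"
    by (rule indep_vars_lebesgue_integral[OF I(1) ind' int])
  finally show ?thesis by (simp add: A_def)
qed

lemma tail_mult_le_chord_power:
  assumes I: "finite I" "I \<noteq> {}" and ind: "indep_vars (\<lambda>_. borel) X I"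
    and ae: "\<And>i. i \<in> I \<Longrightarrow> AE \<omega> in M. 0 \<le> X i \<omega> \<and> X i \<omega> \<le> 1"
    and f: "f \<in> F_sic" and t: "t \<ge> 0"
  defines "p \<equiv> (\<Sum>i\<in>I. expectation (X i)) / card I"
  shows "f t * prob {\<omega> \<in> space M. (\<Sum>i\<in>I. X i \<omega>) \<ge> t} \<le> ((1 - p) * f 0 + p * f 1) ^ card I"
proof -
  let ?E = "\<lambda>i. expectation (\<lambda>\<omega>. f (unit_clamp (X i \<omega>)))"
  let ?c = "\<lambda>i. (1 - expectation (X i)) * f 0 + expectation (X i) * f 1"
  have rv: "random_variable borel (X i)" if "i \<in> I" for i
    using ind that by (auto simp: indep_vars_def)
  have E: "0 \<le> ?E i" for i
    by (intro integral_nonneg_AE) (simp add: unit_clamp_value_bounds(1)[OF f])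
  have Ec: "?E i \<le> ?c i" if "i \<in> I" for i
    by (rule expectation_unit_clamp_le_chord[OF f rv[OF that] ae[OF that]])
  have c: "0 \<le> ?c i" if "i \<in> I" for i
    using E[of i] Ec[OF that] by linarith
  have "f t * prob {\<omega> \<in> space M. (\<Sum>i\<in>I. X i \<omega>) \<ge> t} \<le> (\<Prod>i\<in>I. ?E i)"
    by (rule markov_submultiplicative[OF I ind ae f t])
  also have "\<dots> \<le> (\<Prod>i\<in>I. ?c i)"
    using E Ec by (intro prod_mono) auto
  also have "\<dots> \<le> ((\<Sum>i\<in>I. ?c i) / card I) ^ card I"
    by (rule prod_le_mean_power[OF I c])
  also have "(\<Sum>i\<in>I. ?c i) / card I = (1 - p) * f 0 + p * f 1"
    using I by (simp add: p_def sum.distrib sum_subtractf field_simps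
        flip: sum_distrib_left sum_distrib_right)
  finally show ?thesis .
qed

end

theorem theorem1p5:
  fixes M :: "'a measure" and n :: nat and X :: "nat \<Rightarrow> 'a \<Rightarrow> real" and p t :: real
  assumes "prob_space M"
    and "n > 0"
    and "prob_space.indep_vars M (\<lambda>_. borel) X {1..n}"
    and "\<And>i. i \<in> {1..n} \<Longrightarrow> AE \<omega> in M. 0 \<le> X i \<omega> \<and> X i \<omega> \<le> 1"
    and "p = (1 / real n) * (\<Sum>i=1..n. integral\<^sup>L M (X i))"
    and "t > 0" and "real n * p < t" and "t < real n"
  shows "measure M {\<omega> \<in> space M. (\<Sum>i=1..n. X i \<omega>) \<ge> t}
    \<le> (INF f \<in> {f \<in> F_sic. f t > 0}. (1 / f t) * ((1 - p) * f 0 + p * f 1) ^ n)"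
proof (rule cINF_greatest)
  show "{f \<in> F_sic. f t > 0} \<noteq> {}"
    using exp_in_F_sic by force
next
  fix f assume "f \<in> {f \<in> F_sic. f t > 0}"
  then have f: "f \<in> F_sic" and pos: "f t > 0" by auto
  interpret prob_space M by fact
  have "f t * prob {\<omega> \<in> space M. (\<Sum>i=1..n. X i \<omega>) \<ge> t} \<le> ((1 - p) * f 0 + p * f 1) ^ n"
    using tail_mult_le_chord_power[OF _ _ assms(3,4) f, of t] assms(2,5,6) by simp
  then show "prob {\<omega> \<in> space M. (\<Sum>i=1..n. X i \<omega>) \<ge> t}
      \<le> (1 / f t) * ((1 - p) * f 0 + p * f 1) ^ n"
    using pos by (simp add: field_simps)
qed

end
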